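(* Every group of type C is isomorphic to a member of one of the following series, where in (C1) the number $r$, and in (C2) and (C3) the number $r'$, is a (possibly empty) product of primes of the form $6z+1$ with positive integers $z$ (so in particular it is not divisible by $3$; repeated primes are allowed): (C1) $C_{rn,n}^{(k)}$ with $n\in\{1,2,3,\ldots\}$ and $k\in\{0,\ldots,r-1\}$, $1+k+k^2\equiv0\pmod r$; (C2) $\mathbb{Z}_3\times C_{r'n,n}^{(k)}$ with $n\ge 1$, $3\nmid n$, and $k\in\{0,\ldots,r-1\}$, $1+k+k^2\equiv 0\pmod{r}$, where $r=3r'$; (C3) $C_{9r'n',3n'}^{(k)}$ with $n'\in\{1,2,3,\ldots\}$ and $k\in\{0,\ldots,r-1\}$, $1+k+k^2\equiv 0\pmod{r}$, where $r=3r'$. Every group of type D is isomorphic to a member of one of the following series: (D1) $D_{n,n}^{(0)}$ with $n\in\{1,2,3,\ldots\}$; (D2) $\mathbb{Z}_3\times D_{n,n}^{(0)}$ with $n\ge1$, $3\nmid n$; (D3) $D_{9n',3n'}^{(1)}$ with $n'\in\{1,2,3,\ldots\}$.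
   Context: Matrices: $$E=\begin{pmatrix}0&1&0\\0&0&1\\1&0&0\end{pmatrix},\qquad B=\begin{pmatrix}-1&0&0\\0&0&-1\\0&-1&0\end{pmatrix}.$$ For integers $\mu\ge 1$, $0\le\alpha,\beta<\mu$ let $F(\mu,\alpha,\beta)=\mathrm{diag}(\eta^{\alpha},\eta^{\beta},\eta^{-\alpha-\beta})$ with $\eta=e^{2\pi i/\mu}$. For integers $\nu\ge 1$, $0\le\rho,\sigma<\nu$ let $$R(\nu,\rho,\sigma)=\begin{pmatrix}\delta^{\rho}&0&0\\0&0&\delta^{\sigma}\\0&-\delta^{-\rho-\sigma}&0\end{pmatrix},\qquad \delta=e^{2\pi i/\nu}.$$ A group of type C is a finite subgroup of $SU(3)$ generated by $E$ and some $F(\mu,\alpha,\beta)$. A group of type D is a finite subgroup of $SU(3)$ generated by $E$, some $F(\mu,\alpha,\beta)$ and some $R(\nu,\rho,\sigma)$. For positive integers $m,n$ with $n\mid m$, $r_0=m/n$, and an integer $k\ge0$ with $1+k+k^2\equiv 0\pmod{r_0}$, $C_{m,n}^{(k)}$ denotes the subgroup of $SU(3)$ generated by $E$, $F=\mathrm{diag}(\epsilon,\epsilon^{k},\epsilon^{-k-1})$ and $G=\mathrm{diag}(1,\epsilon^{-r_0},\epsilon^{r_0})$, where $\epsilon=\exp(2\pi i/m)$. If in addition $1+2k\equiv0\pmod{r_0}$, $D_{m,n}^{(k)}$ denotes the subgroup generated by $E,F,G,B$. These groups depend on $k$ only modulo $r_0$. $\mathbb{Z}_3$ is the cyclic group of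 order 3. *)

theory Defs
  imports
    "HOL-Analysis.Analysis"
    "HOL-Algebra.Elementary_Groups"
    "HOL-Number_Theory.Cong"
begin

definition conj_transpose :: "complex^3^3 \<Rightarrow> complex^3^3" where
  "conj_transpose A = (\<chi> i j. cnj (A $ j $ i))"

definition SU3 :: "(complex^3^3) monoid" where
  "SU3 = \<lparr>carrier = {A. A ** conj_transpose A = mat 1 \<and> conj_transpose A ** A = mat 1 \<and> det A = 1},
          mult = (**), one = mat 1\<rparr>"

definition mat3 :: "complex list list \<Rightarrow> complex^3^3" where
  "mat3 xss = vector (map vector xss)"

definition diag3 :: "complex \<Rightarrow> complex \<Rightarrow> complex \<Rightarrow> complex^3^3" where
  "diag3 a b c = mat3 [[a, 0, 0],
                       [0, b, 0],
                       [0, 0, c]]"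

definition root_unity :: "nat \<Rightarrow> complex" where
  "root_unity n = exp (2 * of_real pi * \<i> / of_nat n)"

definition E_mat :: "complex^3^3" where
  "E_mat = mat3 [[0, 1, 0],
                 [0, 0, 1],
                 [1, 0, 0]]"

definition B_mat :: "complex^3^3" where
  "B_mat = mat3 [[-1,  0,  0],
                 [ 0,  0, -1],
                 [ 0, -1,  0]]"

definition F_mat :: "nat \<Rightarrow> nat \<Rightarrow> nat \<Rightarrow> complex^3^3" where
  "F_mat \<mu> \<alpha> \<beta> = (let \<eta> = root_unity \<mu> in
     diag3 (\<eta> ^ \<alpha>) (\<eta> ^ \<beta>) (\<eta> powi (- int \<alpha> - int \<beta>)))"

definition R_mat :: "nat \<Rightarrow> nat \<Rightarrow> nat \<Rightarrow> complex^3^3" where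
  "R_mat \<nu> \<rho> \<sigma> = (let \<delta> = root_unity \<nu> in
     mat3 [[\<delta> ^ \<rho>, 0, 0],
           [0, 0, \<delta> ^ \<sigma>],
           [0, - (\<delta> powi (- int \<rho> - int \<sigma>)), 0]])"

definition type_C :: "(complex^3^3) set \<Rightarrow> bool" where
  "type_C H \<longleftrightarrow> subgroup H SU3 \<and> finite H \<and>
     (\<exists>\<mu> \<alpha> \<beta>. \<mu> \<ge> 1 \<and> \<alpha> < \<mu> \<and> \<beta> < \<mu> \<and> H = generate SU3 {E_mat, F_mat \<mu> \<alpha> \<beta>})"

definition type_D :: "(complex^3^3) set \<Rightarrow> bool" where
  "type_D H \<longleftrightarrow> subgroup H SU3 \<and> finite H \<and>
     (\<exists>\<mu> \<alpha> \<beta> \<nu> \<rho> \<sigma>. \<mu> \<ge> 1 \<and> \<alpha> < \<mu> \<and> \<beta> < \<mu> \<and> \<nu> \<ge> 1 \<and> \<rho> < \<nu> \<and> \<sigma> < \<nu> \<and>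
        H = generate SU3 {E_mat, F_mat \<mu> \<alpha> \<beta>, R_mat \<nu> \<rho> \<sigma>})"

definition F_series :: "nat \<Rightarrow> nat \<Rightarrow> complex^3^3" where
  "F_series m k = (let \<epsilon> = root_unity m in
     diag3 \<epsilon> (\<epsilon> ^ k) (\<epsilon> powi (- int k - 1)))"

definition G_series :: "nat \<Rightarrow> nat \<Rightarrow> complex^3^3" where
  "G_series m n = (let \<epsilon> = root_unity m; r0 = int (m div n) in
     diag3 1 (\<epsilon> powi (- r0)) (\<epsilon> powi r0))"

text \<open>
  The groups \<open>C\<^bsub>m,n\<^esub>\<^sup>(\<^sup>k\<^sup>)\<close> and \<open>D\<^bsub>m,n\<^esub>\<^sup>(\<^sup>k\<^sup>)\<close> are meant for \<open>m, n > 0\<close>, \<open>n dvd m\<close> and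
  \<open>1 + k + k\<^sup>2 \<equiv> 0\<close> modulo \<open>m div n\<close>, and in the case of \<open>D\<close> also \<open>1 + 2 k \<equiv> 0\<close> modulo \<open>m div n\<close>.
  The definitions do not enforce these conditions.
\<close>

definition C_group :: "nat \<Rightarrow> nat \<Rightarrow> nat \<Rightarrow> (complex^3^3) monoid" where
  "C_group m n k = SU3\<lparr>carrier := generate SU3 {E_mat, F_series m k, G_series m n}\<rparr>"

definition D_group :: "nat \<Rightarrow> nat \<Rightarrow> nat \<Rightarrow> (complex^3^3) monoid" where
  "D_group m n k = SU3\<lparr>carrier := generate SU3 {E_mat, F_series m k, G_series m n, B_mat}\<rparr>"

definition prod_primes_6z1 :: "nat \<Rightarrow> bool" where
  "prod_primes_6z1 r \<longleftrightarrow>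
     (\<exists>P. (\<forall>p \<in># P. prime p \<and> (\<exists>z\<ge>1. p = 6 * z + 1)) \<and> r = prod_mset P)"

text \<open>The generators lie in \<open>SU3\<close>, so \<open>generate SU3\<close> forms the generated subgroup.\<close>

lemma conj_transpose_mult: "conj_transpose (A ** B) = conj_transpose B ** conj_transpose A"
  by (simp add: conj_transpose_def matrix_matrix_mult_def vec_eq_iff cnj_sum mult.commute)

lemma conj_transpose_idem [simp]: "conj_transpose (conj_transpose A) = A"
  by (simp add: conj_transpose_def vec_eq_iff)

lemma conj_transpose_one [simp]: "conj_transpose (mat 1) = mat 1"
  by (simp add: conj_transpose_def vec_eq_iff mat_def)

lemma det_conj_transpose: "det (conj_transpose A) = cnj (det A)"
  by (simp add: conj_transpose_def det_3)

lemma group_SU3: "group SU3"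
proof (rule groupI)
  fix A B assume "A \<in> carrier SU3" "B \<in> carrier SU3"
  then have A: "A ** conj_transpose A = mat 1" "conj_transpose A ** A = mat 1" "det A = 1"
    and B: "B ** conj_transpose B = mat 1" "conj_transpose B ** B = mat 1" "det B = 1"
    by (auto simp: SU3_def)
  have "(A ** B) ** conj_transpose (A ** B) = A ** ((B ** conj_transpose B) ** conj_transpose A)"
    by (simp only: conj_transpose_mult matrix_mul_assoc)
  moreover have "conj_transpose (A ** B) ** (A ** B)
      = conj_transpose B ** ((conj_transpose A ** A) ** B)"
    by (simp only: conj_transpose_mult matrix_mul_assoc)
  ultimately show "A \<otimes>\<^bsub>SU3\<^esub> B \<in> carrier SU3"
    using A B by (simp add: SU3_def det_mul)
next
  fix A assume A: "A \<in> carrier SU3"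
  show "\<exists>B\<in>carrier SU3. B \<otimes>\<^bsub>SU3\<^esub> A = \<one>\<^bsub>SU3\<^esub>"
    by (rule bexI[of _ "conj_transpose A"]) (use A in \<open>auto simp: SU3_def det_conj_transpose\<close>)
qed (auto simp: SU3_def matrix_mul_assoc)

lemma root_unity_cnj_mult: "root_unity n * cnj (root_unity n) = 1"
  by (simp add: root_unity_def exp_cnj flip: exp_add)

lemma root_unity_nonzero [simp]: "root_unity n \<noteq> 0"
  by (simp add: root_unity_def)

lemma cnj_root_unity: "cnj (root_unity n) = inverse (root_unity n)"
  by (metis inverse_unique root_unity_cnj_mult)

lemma cnj_power_int_root_unity: "cnj (root_unity n powi i) = root_unity n powi (- i)"
  by (cases "i \<ge> 0") (auto simp: power_int_def cnj_root_unity power_inverse)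

lemma mat3_in_SU3_iff:
  "mat3 [[a, b, c], [d, e, f], [g, h, i]] \<in> carrier SU3 \<longleftrightarrow>
     (let M = mat3 [[a, b, c], [d, e, f], [g, h, i]] in
        M ** conj_transpose M = mat 1 \<and> conj_transpose M ** M = mat 1) \<and>
     a * e * i + b * f * g + c * d * h - a * f * h - b * d * i - c * e * g = 1"
  by (auto simp: SU3_def det_3 mat3_def Let_def)

lemma E_in_SU3: "E_mat \<in> carrier SU3"
  and B_in_SU3: "B_mat \<in> carrier SU3"
  unfolding E_mat_def B_mat_def mat3_in_SU3_iff
  by (simp_all add: mat3_def conj_transpose_def matrix_matrix_mult_def vec_eq_iff mat_def
      forall_3 sum_3)

lemma diag3_in_SU3:
  assumes "a + b + c = 0"
  shows "diag3 (root_unity n powi a) (root_unity n powi b) (root_unity n powi c) \<in> carrier SU3"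
proof -
  have "root_unity n powi a * root_unity n powi b * root_unity n powi c = 1"
    using assms by (simp flip: power_int_add)
  then show ?thesis
    unfolding diag3_def mat3_in_SU3_iff
    by (simp add: mat3_def conj_transpose_def matrix_matrix_mult_def vec_eq_iff mat_def
        forall_3 sum_3 cnj_power_int_root_unity flip: power_int_add del: complex_cnj_power_int)
qed

lemma F_in_SU3: "F_mat \<mu> \<alpha> \<beta> \<in> carrier SU3"
  using diag3_in_SU3[of "int \<alpha>" "int \<beta>" "- int \<alpha> - int \<beta>" \<mu>] by (simp add: F_mat_def Let_def)

lemma F_series_in_SU3: "F_series m k \<in> carrier SU3"
  using diag3_in_SU3[of 1 "int k" "- int k - 1" m] by (simp add: F_series_def Let_def)

lemma G_series_in_SU3: "G_series m n \<in> carrier SU3"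
  using diag3_in_SU3[of 0 "- int (m div n)" "int (m div n)" m] by (simp add: G_series_def Let_def)

lemma R_in_SU3: "R_mat \<nu> \<rho> \<sigma> \<in> carrier SU3"
proof -
  have "root_unity \<nu> powi int \<rho> * root_unity \<nu> powi int \<sigma>
      * root_unity \<nu> powi (- int \<rho> - int \<sigma>) = 1"
    by (simp flip: power_int_add del: power_int_of_nat)
  then have "mat3 [[root_unity \<nu> powi int \<rho>, 0, 0], [0, 0, root_unity \<nu> powi int \<sigma>],
      [0, - (root_unity \<nu> powi (- int \<rho> - int \<sigma>)), 0]] \<in> carrier SU3"
    unfolding mat3_in_SU3_iff
    by (simp add: mat3_def conj_transpose_def matrix_matrix_mult_def vec_eq_iff mat_def
        forall_3 sum_3 cnj_power_int_root_unity flip: power_int_add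
        del: complex_cnj_power_int power_int_of_nat)
  then show ?thesis by (simp add: R_mat_def Let_def)
qed

end

theory Submission
  imports Defs "HOL-Number_Theory.Residues"
begin

text \<open>
  The diagonal matrices of a type C or D group have entries \<open>\<epsilon>\<^sup>a, \<epsilon>\<^sup>b, \<epsilon>\<^bsup>-a-b\<^esup>\<close> for one root of
  unity \<open>\<epsilon>\<close> of order \<open>M\<close>, and the exponents \<open>(a, b)\<close> form a sublattice of \<open>\<int>\<^sup>2\<close> containing \<open>M \<int>\<^sup>2\<close>.
  Conjugation by \<open>E\<close> makes it an ideal of the Eisenstein integers, so it has a basis
  \<open>d (1, k), d (0, r)\<close> with \<open>r\<close> dividing \<open>1 + k + k\<^sup>2\<close>; these two vectors are exactly the generators
  \<open>F\<close> and \<open>G\<close> of \<open>C\<^bsub>rn,n\<^esub>\<close> with \<open>M = d r n\<close>. In type D the lattice is also stable under conjugation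
  by \<open>B\<close>, which forces \<open>r\<close> to divide \<open>3\<close>. When \<open>3\<close> divides \<open>r\<close> but not \<open>n\<close>, the centre of \<open>SU(3)\<close>
  splits off as a direct factor.
\<close>

interpretation SU3: group SU3
  by (rule group_SU3)

section \<open>Diagonal matrices with entries powers of one root of unity\<close>

lemma root_unity_mult_power:
  assumes "c > 0"
  shows "root_unity (c * m) ^ c = root_unity m"
  using assms by (simp add: root_unity_def flip: exp_of_nat_mult)

lemma root_unity_power_self [simp]: "root_unity m ^ m = 1"
  by (cases "m = 0") (simp_all add: root_unity_def flip: exp_of_nat_mult)

lemma root_unity_power_eq_1_iff:
  assumes "m > 0"
  shows "root_unity m ^ j = 1 \<longleftrightarrow> m dvd j"
  using complex_root_unity_eq_1[of m j] assms
  by (simp add: root_unity_def mult_ac flip: exp_of_nat_mult)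

lemma root_unity_mult_powi:
  assumes "c > 0"
  shows "root_unity (c * m) powi (int c * a) = root_unity m powi a"
  by (simp add: power_int_mult root_unity_mult_power[OF assms])

text \<open>Determinant 1 fixes the third exponent, so two exponents suffice. They are integers,
  which makes products and inverses the addition and negation of vectors in \<int>^2.\<close>

definition tor :: "nat \<Rightarrow> int \<Rightarrow> int \<Rightarrow> complex^3^3" where
  "tor m a b = diag3 (root_unity m powi a) (root_unity m powi b) (root_unity m powi (- a - b))"

lemma tor_in_SU3 [simp]: "tor m a b \<in> carrier SU3"
  unfolding tor_def by (rule diag3_in_SU3) simp

lemma SU3_simps [simp]: "mult SU3 = (**)" "one SU3 = mat 1"
  by (simp_all add: SU3_def)

lemmas mat3_simps = mat3_def diag3_def matrix_matrix_mult_def vec_eq_iff forall_3 sum_3 mat_def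

lemma diag3_mult: "diag3 a b c ** diag3 a' b' c' = diag3 (a * a') (b * b') (c * c')"
  by (simp add: mat3_simps)

lemma tor_mult: "tor m a b ** tor m a' b' = tor m (a + a') (b + b')"
  by (simp add: tor_def diag3_mult algebra_simps flip: power_int_add)

lemma tor_0 [simp]: "tor m 0 0 = mat 1"
  by (simp add: tor_def mat3_simps)

lemma tor_inv: "inv\<^bsub>SU3\<^esub> tor m a b = tor m (- a) (- b)"
  by (rule SU3.inv_equality) (simp_all add: tor_mult)

text \<open>Serves to write diagonal matrices given over different roots of unity over one common
  root.\<close>

lemma tor_mult_cancel:
  assumes "c > 0"
  shows "tor (c * m) (int c * a) (int c * b) = tor m a b"
  using root_unity_mult_powi[OF assms, of m] unfolding tor_def
  by (metis minus_diff_eq minus_mult_right right_diff_distrib diff_minus_eq_add mult_minus_right)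

lemma tor_period: "tor m (int m) 0 = mat 1" "tor m 0 (int m) = mat 1"
  by (simp_all add: tor_def mat3_simps power_int_minus)

lemma F_mat_eq_tor: "F_mat \<mu> \<alpha> \<beta> = tor \<mu> \<alpha> \<beta>"
  by (simp add: F_mat_def tor_def Let_def)

lemma F_series_eq_tor: "F_series m k = tor m 1 k"
  by (simp add: F_series_def tor_def Let_def minus_diff_commute[of "int k"])

lemma G_series_eq_tor: "G_series m n = tor m 0 (- int (m div n))"
  by (simp add: G_series_def tor_def Let_def)

section \<open>Action of E and B on exponent vectors\<close>

lemma E_mat_conj_tor:
  "E_mat ** tor m a b ** (E_mat ** E_mat) = tor m b (- a - b)"
  by (simp add: tor_def E_mat_def mat3_simps)

lemma E_mat_cube: "E_mat ** (E_mat ** E_mat) = mat 1"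
  by (simp add: E_mat_def mat3_simps)

lemma E_mat_inv: "inv\<^bsub>SU3\<^esub> E_mat = E_mat ** E_mat"
proof (rule SU3.inv_equality)
  show "E_mat ** E_mat \<in> carrier SU3"
    using SU3.m_closed[OF E_in_SU3 E_in_SU3] by simp
qed (simp_all add: E_in_SU3 E_mat_cube flip: matrix_mul_assoc)

lemma B_mat_square: "B_mat ** B_mat = mat 1"
  by (simp add: B_mat_def mat3_simps)

lemma B_mat_inv: "inv\<^bsub>SU3\<^esub> B_mat = B_mat"
  by (rule SU3.inv_equality) (simp_all add: B_in_SU3 B_mat_square)

lemma B_mat_conj_tor: "B_mat ** tor m a b ** B_mat = tor m a (- a - b)"
  by (simp add: tor_def B_mat_def mat3_simps)

section \<open>Exponent vectors inside a subgroup\<close>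

lemma subgroup_SU3_mult:
  assumes "subgroup S SU3" "A \<in> S" "A' \<in> S"
  shows "A ** A' \<in> S"
  using subgroup.m_closed[OF assms] by simp

lemma tor_multiple_mem:
  assumes S: "subgroup S SU3" and t: "tor m a b \<in> S"
  shows "tor m (c * a) (c * b) \<in> S"
proof -
  have nat: "tor m (int i * a) (int i * b) \<in> S" for i
  proof (induction i)
    case 0
    show ?case using subgroup.one_closed[OF S] by simp
  next
    case (Suc i)
    show ?case
      using subgroup_SU3_mult[OF S t Suc.IH] by (simp add: tor_mult algebra_simps)
  qed
  show ?thesis
  proof (cases "c \<ge> 0")
    case True
    then show ?thesis using nat[of "nat c"] by simp
  next
    case False
    then show ?thesis
      using subgroup.m_inv_closed[OF S nat[of "nat (- c)"]] by (simp add: tor_inv)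
  qed
qed

text \<open>The exponent vectors of \<open>F\<close> and \<open>G\<close> are \<open>(1, k)\<close>
  and \<open>(0, -r)\<close>. If \<open>b - k * a = r * c\<close>, then \<open>(a, b)\<close> is
  \<open>a\<close> times the first minus \<open>c\<close> times the second.\<close>

lemma tor_mem_if_series_mem:
  assumes S: "subgroup S SU3" and "F_series (r * n) k \<in> S" "G_series (r * n) n \<in> S"
    and "n > 0" "int r dvd b - int k * a"
  shows "tor (r * n) a b \<in> S"
proof -
  obtain c where c: "b - int k * a = int r * c"
    using assms by blast
  have "tor (r * n) (a * 1) (a * int k) ** tor (r * n) ((- c) * 0) ((- c) * (- int r)) \<in> S"
    using assms by (intro subgroup_SU3_mult[OF S] tor_multiple_mem[OF S])
      (simp_all add: F_series_eq_tor G_series_eq_tor)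
  also have "a * int k + (- c) * (- int r) = b"
    using c by (simp add: algebra_simps)
  ultimately show ?thesis
    by (simp add: tor_mult)
qed

section \<open>Sublattices of \<int>^2 stable under a shift of order 3\<close>

text \<open>The least positive member \<open>d\<close> generates: a remainder modulo
  \<open>d\<close> is again a member and smaller than \<open>d\<close>, hence 0.\<close>

lemma int_subgroup_eq_multiples:
  fixes S :: "int \<Rightarrow> bool"
  assumes diff: "\<And>a b. S a \<Longrightarrow> S b \<Longrightarrow> S (a - b)" and M: "S M" "M > 0"
  obtains d :: nat where "d > 0" "\<And>a. S a \<longleftrightarrow> int d dvd a"
proof -
  define d where "d = (LEAST i :: nat. i > 0 \<and> S (int i))"
  have d: "d > 0" "S (int d)"
    using LeastI[of "\<lambda>i. i > 0 \<and> S (int i)" "nat M"] M by (auto simp: d_def)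
  have min: "\<not> S (int i)" if "0 < i" "i < d" for i
    using that not_less_Least[of i "\<lambda>i. i > 0 \<and> S (int i)"] by (auto simp: d_def)
  have zero: "S 0"
    using diff[OF M(1) M(1)] by simp
  have neg: "S (- a)" if "S a" for a
    using diff[OF zero that] by simp
  have nat: "S (int i * int d)" for i
  proof (induction i)
    case (Suc i)
    show ?case using diff[OF Suc.IH neg[OF d(2)]] by (simp add: algebra_simps)
  qed (use zero in simp)
  have mult: "S (c * int d)" for c
    using nat[of "nat c"] neg[OF nat[of "nat (- c)"]] by (cases "c \<ge> 0") auto
  have "S a \<longleftrightarrow> int d dvd a" for a
  proof
    assume "int d dvd a"
    then show "S a" using mult by (auto simp: dvd_def mult.commute)
  next
    assume "S a"
    then have "S (a mod int d)"
      using diff[OF _ mult[of "a div int d"], of a] by (simp add: minus_div_mult_eq_mod)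
    then have "\<not> (0 < a mod int d \<and> a mod int d < int d)"
      using min[of "nat (a mod int d)"] by (auto simp: nat_less_iff)
    then have "a mod int d = 0"
      using d(1) pos_mod_bound[of "int d" a] pos_mod_sign[of "int d" a] by linarith
    then show "int d dvd a" by auto
  qed
  with d(1) show ?thesis by (rule that)
qed

text \<open>
  The Hermite normal form of an ideal of the Eisenstein integers containing \<open>M\<close>; the map
  \<open>(a, b) \<mapsto> (b, -a - b)\<close> is multiplication by a primitive cube root of unity.
\<close>
lemma shift_lattice_normal_form:
  fixes L :: "int \<Rightarrow> int \<Rightarrow> bool" and M :: nat
  assumes diff: "\<And>a b a' b'. L a b \<Longrightarrow> L a' b' \<Longrightarrow> L (a - a') (b - b')"
    and shift: "\<And>a b. L a b \<Longrightarrow> L b (- a - b)"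
    and M: "M > 0" "L (int M) 0" "L 0 (int M)"
  obtains d r n k :: nat where "d > 0" "r > 0" "n > 0" "M = d * (r * n)" "k < r"
    "r dvd 1 + k + k\<^sup>2"
    "\<And>a b. L a b \<longleftrightarrow> (\<exists>a' b'. a = int d * a' \<and> b = int d * b' \<and> int r dvd b' - int k * a')"
proof -
  \<comment> \<open>\<open>d\<close> generates the group of first coordinates of \<open>L\<close>,
    and \<open>e\<close> below generates the second coordinates of the vectors \<open>(0, b)\<close>
    in \<open>L\<close>.\<close>
  obtain d where d: "d > 0" "\<And>a. (\<exists>b. L a b) \<longleftrightarrow> int d dvd a"
    by (rule int_subgroup_eq_multiples[of "\<lambda>a. \<exists>b. L a b" "int M"]) (use diff M in \<open>auto, blast\<close>)
  obtain e where e: "e > 0" "\<And>b. L 0 b \<longleftrightarrow> int e dvd b"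
    by (rule int_subgroup_eq_multiples[of "\<lambda>b. L 0 b" "int M"])
      (use diff[of 0 _ 0] M in auto)
  \<comment> \<open>The shift moves the second coordinate into first place, so \<open>d\<close>
    divides both.\<close>
  have dvd: "int d dvd a" "int d dvd b" if "L a b" for a b
    using that shift[OF that] d(2)[of a] d(2)[of b] by auto
  have "L 0 (int e)" using e by simp
  then have "d dvd e" using dvd(2) by fastforce
  then obtain r where r: "e = d * r" by blast
  have "e dvd M" using M(3) e(2) by simp
  then obtain n where n: "M = d * r * n" using r by blast
  have pos: "r > 0" "n > 0" using r n e(1) M(1) by auto
  obtain c where "L (int d) c" using d(2)[of "int d"] by auto
  moreover from this obtain k0 where "c = int d * k0" using dvd(2) by blast
  ultimately have k0: "L (int d) (int d * k0)" by simp
  \<comment> \<open>Since \<open>(0, d * r)\<close> lies in \<open>L\<close>, the slope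
    \<open>k0\<close> may be reduced modulo \<open>r\<close>.\<close>
  define k where "k = nat (k0 mod int r)"
  have k: "int k = k0 mod int r" "k < r"
    using pos by (auto simp: k_def nat_less_iff)
  have zero: "L 0 (int d * b) \<longleftrightarrow> int r dvd b" for b
    using d(1) by (simp add: e(2) r)
  have sub: "L a b \<longleftrightarrow> L 0 (b - b')" if "L a b'" for a b b'
    using diff[of a b a b'] diff[OF that, of 0 "b' - b"] diff[of 0 0 0 "b - b'"] e(2)[of 0] that
    by auto
  have "int r dvd k0 - int k"
    by (simp add: k(1) minus_mod_eq_mult_div)
  then have base: "L (int d) (int d * int k)"
    using sub[OF k0, of "int d * int k"] zero[of "int k - k0"]
    by (simp add: right_diff_distrib dvd_diff_commute)
  have mults: "L (int d * a) (int d * (int k * a))" for a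
  proof -
    have *: "L (int d * int i) (int d * (int k * int i))" for i
    proof (induction i)
      case 0
      then show ?case using e(2)[of 0] by simp
    next
      case (Suc i)
      have "L (- int d) (- (int d * int k))"
        using diff[OF _ base, of 0 0] e(2)[of 0] by simp
      from diff[OF Suc.IH this] show ?case by (simp add: algebra_simps)
    qed
    show ?thesis
    proof (cases "a \<ge> 0")
      case True
      then show ?thesis using *[of "nat a"] by simp
    next
      case False
      then show ?thesis using diff[OF _ *[of "nat (- a)"], of 0 0] e(2)[of 0] by simp
    qed
  qed
  have char: "L (int d * a) (int d * b) \<longleftrightarrow> int r dvd b - int k * a" for a b
    using sub[OF mults[of a], of "int d * b"] zero[of "b - int k * a"]
    by (simp add: right_diff_distrib)
  \<comment> \<open>The shift sends \<open>d (1, k)\<close> to \<open>d (k, -1 - k)\<close>. By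
    \<open>char\<close>, membership of this vector says that \<open>r\<close> divides
    \<open>-1 - k - k * k\<close>.\<close>
  have "L (int d * int k) (int d * (- 1 - int k))"
    using shift[OF base] by (simp add: algebra_simps)
  then have "int r dvd - (- 1 - int k - int k * int k)"
    unfolding char dvd_minus_iff .
  then have "int r dvd int (1 + k + k\<^sup>2)"
    by (simp add: power2_eq_square algebra_simps)
  then have "r dvd 1 + k + k\<^sup>2"
    by (simp only: of_nat_dvd_iff)
  moreover have "L a b \<longleftrightarrow>
      (\<exists>a' b'. a = int d * a' \<and> b = int d * b' \<and> int r dvd b' - int k * a')" for a b
  proof
    assume L: "L a b"
    obtain a' where a': "a = int d * a'" using dvd(1)[OF L] by blast
    obtain b' where b': "b = int d * b'" using dvd(2)[OF L] by blast
    show "\<exists>a' b'. a = int d * a' \<and> b = int d * b' \<and> int r dvd b' - int k * a'"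
      by (rule exI[of _ a'], rule exI[of _ b']) (use L char in \<open>simp add: a' b'\<close>)
  qed (use char in blast)
  ultimately show ?thesis
    using that[of d r n k] d(1) pos n k(2) by (simp add: mult.assoc)
qed

section \<open>Divisors of 1 + k + k^2\<close>

text \<open>A prime factor \<open>p\<close> of \<open>r\<close> is odd, because 1 + k + k^2 is odd,
  and differs from 3. Modulo \<open>p\<close> the number \<open>k\<close> is a nontrivial cube root
  of 1, which by Fermat rules out \<open>p mod 3 = 2\<close>.\<close>

lemma prod_primes_6z1_if_dvd:
  fixes r k :: nat
  assumes r: "r dvd 1 + k + k\<^sup>2" and 3: "\<not> 3 dvd r"
  shows "prod_primes_6z1 r"
proof -
  have prime3: "prime (3::nat)" by simp
  have "r \<noteq> 0" using r by (metis add_is_0 dvd_0_left_iff one_neq_zero)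
  have "\<exists>z\<ge>1. p = 6 * z + 1" if "prime p" "p dvd r" for p
  proof -
    have p: "p dvd 1 + k + k\<^sup>2" using that(2) r by (rule dvd_trans)
    have p3: "p \<noteq> 3" using that(2) 3 by blast
    have "odd (1 + k + k\<^sup>2)" by simp
    then have "odd p" using p dvd_trans by blast
    have "\<not> p dvd k"
    proof
      assume k: "p dvd k"
      then have "p dvd k + k\<^sup>2" by (simp add: power2_eq_square)
      then have "p dvd 1" using p by (metis add.assoc dvd_add_left_iff)
      then show False using \<open>prime p\<close> by simp
    qed
    then have fermat: "[k ^ (p - 1) = 1] (mod p)"
      by (rule fermat_theorem[OF \<open>prime p\<close>])
    have "int p dvd int (1 + k + k\<^sup>2)" using p by (simp only: of_nat_dvd_iff)
    \<comment> \<open>This multiple is k^3 - 1.\<close>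
    then have "int p dvd (int k - 1) * int (1 + k + k\<^sup>2)" by simp
    also have "(int k - 1) * int (1 + k + k\<^sup>2) = int (k ^ 3) - int 1"
      by (simp add: algebra_simps power2_eq_square power3_eq_cube)
    finally have "[int (k ^ 3) = int 1] (mod int p)"
      by (simp only: cong_iff_dvd_diff)
    then have cube: "[k ^ 3 = 1] (mod p)" by (simp only: cong_int_iff)
    \<comment> \<open>Otherwise \<open>p - 1\<close> is 1 modulo 3, so \<open>k ^ (p - 1)\<close>
      reduces to \<open>k\<close> and Fermat gives k = 1 modulo \<open>p\<close>. Then
      \<open>p\<close> divides 1 + 1 + 1 = 3.\<close>
    have "p mod 3 \<noteq> 2"
    proof
      assume "p mod 3 = 2"
      then have "p - 1 = 3 * (p div 3) + 1" by presburger
      then have "k ^ (p - 1) = (k ^ 3) ^ (p div 3) * k" by (simp add: power_mult)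
      moreover have "[(k ^ 3) ^ (p div 3) * k = 1 ^ (p div 3) * k] (mod p)"
        by (intro cong_mult cong_pow cube cong_refl)
      ultimately have "[k = 1] (mod p)" using fermat by (metis cong_sym cong_trans mult_1 power_one)
      then have "[1 + k + k\<^sup>2 = 1 + 1 + 1\<^sup>2] (mod p)"
        by (intro cong_add cong_pow cong_refl)
      then have "p dvd 1 + 1 + 1\<^sup>2" using p cong_dvd_iff by blast
      then have "p dvd 3" by (simp add: numeral_3_eq_3)
      then show False using p3 \<open>prime p\<close> prime3 by (metis primes_dvd_imp_eq)
    qed
    moreover have "p mod 3 \<noteq> 0" using p3 \<open>prime p\<close>
      prime3
      by (metis dvd_eq_mod_eq_0 primes_dvd_imp_eq)
    ultimately have "p mod 6 = 1" using \<open>odd p\<close> by presburger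
    then have "p = 6 * (p div 6) + 1" by presburger
    moreover have "p div 6 \<ge> 1"
      using \<open>prime p\<close> calculation prime_gt_1_nat[of p] by linarith
    ultimately show ?thesis by blast
  qed
  then have "\<forall>p \<in># prime_factorization r. prime p \<and> (\<exists>z\<ge>1. p = 6 * z + 1)"
    by (meson in_prime_factors_iff)
  moreover have "r = prod_mset (prime_factorization r)"
    using \<open>r \<noteq> 0\<close> by (simp add: prod_mset_prime_factorization_nat)
  ultimately show ?thesis
    unfolding prod_primes_6z1_def by (intro exI conjI)
qed

lemma mod_3_eq_1_if_dvd:
  fixes k :: nat
  assumes "3 dvd 1 + k + k\<^sup>2"
  shows "k mod 3 = 1"
proof -
  have "[1 + k + k\<^sup>2 = 1 + k mod 3 + (k mod 3)\<^sup>2] (mod 3)"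
    by (intro cong_add cong_pow cong_refl) (simp_all add: cong_def)
  then have *: "[1 + k mod 3 + (k mod 3)\<^sup>2 = 0] (mod 3)"
    using assms by (metis cong_0_iff cong_sym cong_trans)
  have "k mod 3 = 0 \<or> k mod 3 = 1 \<or> k mod 3 = 2" by presburger
  then show ?thesis
    using * by (elim disjE) (simp_all add: cong_def)
qed

text \<open>Divisibility by 3 forces k = 3i + 1, and then the value is 3 modulo 9. Hence a divisor
  \<open>r\<close> of such a value is either prime to 3 or 3 times a number prime to 3.\<close>

lemma not_9_dvd_eisenstein_norm: "\<not> 9 dvd 1 + k + k\<^sup>2" for k :: nat
proof
  assume "9 dvd 1 + k + k\<^sup>2"
  have "3 dvd 1 + k + k\<^sup>2" using \<open>9 dvd _\<close> by (rule dvd_trans[rotated]) simp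
  then have "k mod 3 = 1" by (rule mod_3_eq_1_if_dvd)
  then obtain i where "k = 3 * i + 1" by (metis mult_div_mod_eq)
  then have "1 + k + k\<^sup>2 = 9 * (i * i + i) + 3" by (simp add: power2_eq_square algebra_simps)
  then show False using \<open>9 dvd _\<close> by presburger
qed

section \<open>The exponent lattice of a group and type C\<close>

text \<open>The normal form applied to the vectors \<open>(a, b)\<close> with
  \<open>tor M a b\<close> in \<open>H\<close>, whose shift is conjugation by \<open>E\<close>. The
  basis vectors become \<open>F_series\<close> and \<open>G_series\<close>. The clause about an
  arbitrary subgroup \<open>S\<close> transfers the diagonal elements of \<open>H\<close> into a
  series group. The last clause treats stability under conjugation by \<open>B\<close>.\<close>

lemma tor_lattice:
  fixes M :: nat
  assumes H: "subgroup H SU3" "E_mat \<in> H" and M: "M > 0"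
  obtains r n k :: nat where "r > 0" "n > 0" "k < r" "r dvd 1 + k + k\<^sup>2"
    "F_series (r * n) k \<in> H" "G_series (r * n) n \<in> H"
    "\<And>S a b. subgroup S SU3 \<Longrightarrow> F_series (r * n) k \<in> S \<Longrightarrow> G_series (r * n) n \<in> S \<Longrightarrow>
       tor M a b \<in> H \<Longrightarrow> tor M a b \<in> S"
    "(\<And>a b. tor M a b \<in> H \<Longrightarrow> tor M a (- a - b) \<in> H) \<Longrightarrow> r dvd 3"
proof -
  let ?L = "\<lambda>a b. tor M a b \<in> H"
  have diff: "?L (a - a') (b - b')" if "?L a b" "?L a' b'" for a b a' b'
    using subgroup_SU3_mult[OF H(1) that(1) subgroup.m_inv_closed[OF H(1) that(2)]]
    by (simp add: tor_inv tor_mult)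
  have shift: "?L b (- a - b)" if "?L a b" for a b
    using that H by (metis E_mat_conj_tor subgroup_SU3_mult)
  have "?L (int M) 0" "?L 0 (int M)"
    using subgroup.one_closed[OF H(1)] by (simp_all add: tor_period)
  note normal_form = shift_lattice_normal_form[of ?L M, OF diff shift M this]
  obtain d r n k where *: "d > 0" "r > 0" "n > 0" "M = d * (r * n)" "k < r"
      "r dvd 1 + k + k\<^sup>2"
    and char: "\<And>a b. ?L a b \<longleftrightarrow>
      (\<exists>a' b'. a = int d * a' \<and> b = int d * b' \<and> int r dvd b' - int k * a')"
    by (rule normal_form; (assumption | rule that; assumption))
  have tor_rn: "tor M (int d * a) (int d * b) = tor (r * n) a b" for a b
    using tor_mult_cancel[OF *(1)] *(4) by simp
  have char': "?L (int d * a) (int d * b) \<longleftrightarrow> int r dvd b - int k * a" for a b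
    using char[of "int d * a" "int d * b"] *(1) by auto
  have F: "F_series (r * n) k \<in> H"
    unfolding F_series_eq_tor tor_rn[symmetric] char' by simp
  have "- int (r * n div n) = - int r" using *(3) by simp
  then have G: "G_series (r * n) n \<in> H"
    unfolding G_series_eq_tor tor_rn[symmetric] char' by simp
  have sub: "tor M a b \<in> S"
    if "subgroup S SU3" "F_series (r * n) k \<in> S" "G_series (r * n) n \<in> S" "?L a b" for S a b
    using that char[of a b] tor_rn tor_mem_if_series_mem[OF that(1-3) *(3)] by metis
  have "r dvd 3" if refl: "\<And>a b. ?L a b \<Longrightarrow> ?L a (- a - b)"
  proof -
    have "?L (int d * 1) (int d * int k)"
      using F by (simp only: F_series_eq_tor tor_rn)
    from refl[OF this] have "?L (int d * 1) (int d * (- 1 - int k))"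
      by (simp add: algebra_simps)
    then have "int r dvd (- 1 - int k) - int k"
      using char'[of 1 "- 1 - int k"] by simp
    \<comment> \<open>The reflection of \<open>(1, k)\<close> shows that \<open>r\<close> divides 1
      + 2k. The constant 3 then comes from 4 (1 + k + k^2) - (1 + 2k)^2 = 3.\<close>
    then have "int r dvd ((- 1 - int k) - int k) * (1 + 2 * int k)" by (rule dvd_mult2)
    moreover have "int r dvd int (1 + k + k\<^sup>2)" using *(6) by (simp only: of_nat_dvd_iff)
    then have "int r dvd int (1 + k + k\<^sup>2) * 4" by (rule dvd_mult2)
    ultimately have "int r dvd
        ((- 1 - int k) - int k) * (1 + 2 * int k) + int (1 + k + k\<^sup>2) * 4"
      by (rule dvd_add)
    also have "\<dots> = int 3"
      by (simp add: algebra_simps power2_eq_square)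
    finally show ?thesis by (simp only: of_nat_dvd_iff)
  qed
  then show ?thesis
    using that[of r n k] *(2,3,5,6) F G sub by blast
qed

text \<open>Each of the two groups contains the generators of the other, so they are equal and not
  merely isomorphic.\<close>

lemma type_C_eq_C_group:
  assumes "type_C H"
  obtains r n k where "r > 0" "n > 0" "k < r" "r dvd 1 + k + k\<^sup>2"
    "SU3\<lparr>carrier := H\<rparr> = C_group (r * n) n k"
proof -
  obtain \<mu> \<alpha> \<beta> where \<mu>: "\<mu> \<ge> 1" and H: "H = generate SU3 {E_mat, F_mat \<mu> \<alpha> \<beta>}" "subgroup H SU3"
    using assms unfolding type_C_def by blast
  have gens: "E_mat \<in> H" "tor \<mu> \<alpha> \<beta> \<in> H"
    unfolding H(1) by (auto intro: generate.incl simp: F_mat_eq_tor)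
  obtain r n k where *: "r > 0" "n > 0" "k < r" "r dvd 1 + k + k\<^sup>2"
      "F_series (r * n) k \<in> H" "G_series (r * n) n \<in> H"
    and sub: "\<And>S a b. subgroup S SU3 \<Longrightarrow> F_series (r * n) k \<in> S \<Longrightarrow> G_series (r * n) n \<in> S \<Longrightarrow>
       tor \<mu> a b \<in> H \<Longrightarrow> tor \<mu> a b \<in> S"
    by (rule tor_lattice[OF H(2) gens(1), of \<mu>]) (use \<mu> in auto)
  let ?S = "generate SU3 {E_mat, F_series (r * n) k, G_series (r * n) n}"
  have S: "subgroup ?S SU3"
    by (rule SU3.generate_is_subgroup) (auto simp: E_in_SU3 F_series_in_SU3 G_series_in_SU3)
  have "tor \<mu> \<alpha> \<beta> \<in> ?S"
    by (rule sub[OF S _ _ gens(2)]) (auto intro: generate.incl)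
  then have "H \<subseteq> ?S"
    unfolding H(1) by (intro SU3.generate_subgroup_incl S) (auto intro: generate.incl simp: F_mat_eq_tor)
  moreover have "?S \<subseteq> H"
    using gens * by (intro SU3.generate_subgroup_incl H) auto
  ultimately have "SU3\<lparr>carrier := H\<rparr> = C_group (r * n) n k"
    unfolding C_group_def by auto
  with * show ?thesis using that by blast
qed

section \<open>From type D to the D series\<close>

lemma root_unity_2: "root_unity 2 = -1"
  by (simp add: root_unity_def)

text \<open>The diagonal factor is diag(-\<delta>^\<rho>, -\<delta>^\<sigma>,
  \<delta>^(-\<rho>-\<sigma>). Its signs require roots of order \<open>2 * \<nu>\<close>, where -1
  is the power with exponent \<nu>.\<close>

lemma R_mat_eq_tor_B:
  assumes "\<nu> > 0"
  shows "R_mat \<nu> \<rho> \<sigma> = tor (2 * \<nu>) (2 * int \<rho> + int \<nu>) (2 * int \<sigma> + int \<nu>) ** B_mat"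
proof -
  have nu: "root_unity (2 * \<nu>) powi int \<nu> = -1"
    using root_unity_mult_power[OF assms, of 2] by (simp add: root_unity_2 mult.commute)
  have powi: "root_unity (2 * \<nu>) powi (2 * a + int \<nu>) = - (root_unity \<nu> powi a)" for a
    using nu root_unity_mult_powi[of 2 \<nu> a] by (simp add: power_int_add)
  have "- (2 * int \<rho> + int \<nu>) - (2 * int \<sigma> + int \<nu>) = 2 * (- int \<rho> - int \<sigma> - int \<nu>)"
    by simp
  moreover have "root_unity (2 * \<nu>) powi (2 * (- int \<rho> - int \<sigma> - int \<nu>))
      = root_unity \<nu> powi (- int \<rho> - int \<sigma> - int \<nu>)"
    using root_unity_mult_powi[of 2 \<nu> "- int \<rho> - int \<sigma> - int \<nu>"] by simp
  moreover have "\<dots> = root_unity \<nu> powi (- int \<rho> - int \<sigma>)"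
    by (simp add: power_int_diff)
  ultimately show ?thesis
    by (simp only: tor_def powi) (simp add: R_mat_def Let_def B_mat_def mat3_simps)
qed

lemma E_mat_conj_tor': "(E_mat ** E_mat) ** tor m a b ** E_mat = tor m (- a - b) a"
  by (simp add: tor_def E_mat_def mat3_simps)

lemma B_mat_E_mat_B_mat: "B_mat ** E_mat ** B_mat = E_mat ** E_mat"
  by (simp add: E_mat_def B_mat_def mat3_simps)

definition tor_conj :: "nat \<Rightarrow> int \<Rightarrow> int \<Rightarrow> complex^3^3 \<Rightarrow> complex^3^3" where
  "tor_conj m u v A = tor m u v ** A ** tor m (- u) (- v)"

lemma tor_conj_hom: "group_hom SU3 SU3 (tor_conj m u v)"
proof (unfold_locales, rule homI)
  fix A A' assume "A \<in> carrier SU3" "A' \<in> carrier SU3"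
  have "tor_conj m u v A ** tor_conj m u v A'
      = tor m u v ** A ** (tor m (- u) (- v) ** tor m u v) ** A' ** tor m (- u) (- v)"
    by (simp only: tor_conj_def matrix_mul_assoc)
  then show "tor_conj m u v (A \<otimes>\<^bsub>SU3\<^esub> A') = tor_conj m u v A \<otimes>\<^bsub>SU3\<^esub> tor_conj m u v A'"
    by (simp add: tor_mult) (simp add: tor_conj_def matrix_mul_assoc)
next
  fix A assume "A \<in> carrier SU3"
  then show "tor_conj m u v A \<in> carrier SU3"
    unfolding tor_conj_def using SU3.m_closed tor_in_SU3 by (metis SU3_simps(1))
qed

lemma inj_tor_conj: "inj (tor_conj m u v)"
proof (rule inj_on_inverseI)
  fix A
  have "tor_conj m (- u) (- v) (tor_conj m u v A)
      = (tor m (- u) (- v) ** tor m u v) ** A ** (tor m (- u) (- v) ** tor m u v)"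
    by (simp only: tor_conj_def matrix_mul_assoc minus_minus)
  then show "tor_conj m (- u) (- v) (tor_conj m u v A) = A"
    by (simp add: tor_mult)
qed

lemma tor_conj_tor [simp]: "tor_conj m u v (tor m' a b) = tor m' a b"
  by (simp add: tor_conj_def tor_def diag3_mult power_int_minus power_int_diff power_int_add field_simps)

text \<open>Since E^3 = 1, a factor E^2 E can be inserted to move the right-hand diagonal matrix
  past E; it stays diagonal with shifted exponents.\<close>

lemma tor_conj_E: "tor_conj m u v E_mat = tor m (u - v) (u + 2 * v) ** E_mat"
proof -
  have "tor_conj m u v E_mat
      = tor m u v ** (E_mat ** tor m (- u) (- v) ** (E_mat ** E_mat)) ** E_mat"
    unfolding tor_conj_def
    by (simp only: E_mat_cube matrix_mul_rid flip: matrix_mul_assoc)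
  then show ?thesis
    by (simp add: E_mat_conj_tor tor_mult algebra_simps)
qed

text \<open>Inserting \<open>B_mat ** B_mat\<close> moves the right-hand diagonal matrix past B,
  which only reflects its exponents.\<close>

lemma tor_conj_tor_B: "tor_conj m u v (tor m u v ** B_mat) = tor m u (u + 3 * v) ** B_mat"
proof -
  have "tor_conj m u v (tor m u v ** B_mat)
      = tor m u v ** tor m u v ** (B_mat ** tor m (- u) (- v) ** B_mat) ** B_mat"
    unfolding tor_conj_def
    by (simp only: B_mat_square matrix_mul_rid flip: matrix_mul_assoc)
  then show ?thesis
    by (simp add: B_mat_conj_tor tor_mult algebra_simps)
qed

lemma mult_mem_cancel:
  assumes "subgroup S SU3" "A \<in> S" "A ** B \<in> S" "B \<in> carrier SU3"
  shows "B \<in> S"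
proof -
  have "inv\<^bsub>SU3\<^esub> A \<otimes>\<^bsub>SU3\<^esub> (A \<otimes>\<^bsub>SU3\<^esub> B) \<in> S"
    using assms(3) subgroup.m_closed[OF assms(1) subgroup.m_inv_closed[OF assms(1,2)]] by simp
  moreover have "inv\<^bsub>SU3\<^esub> A \<otimes>\<^bsub>SU3\<^esub> (A \<otimes>\<^bsub>SU3\<^esub> B) = B"
    using assms(4) subgroup.mem_carrier[OF assms(1,2)]
    by (simp add: SU3.m_assoc[symmetric] del: SU3_simps)
  ultimately show ?thesis by simp
qed

text \<open>
  Writing \<open>R = D B\<close> with \<open>D\<close> diagonal, conjugation by \<open>D\<close> turns the generators \<open>E\<close> and \<open>R\<close> into
  \<open>E\<close> and \<open>B\<close> up to diagonal factors that already lie in the group.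
\<close>
lemma type_D_iso_D_group:
  assumes "type_D H"
  obtains r n k where "n > 0" "k < r" "r dvd 1 + k + k\<^sup>2" "r dvd 3"
    "SU3\<lparr>carrier := H\<rparr> \<cong> D_group (r * n) n k"
proof -
  obtain \<mu> \<alpha> \<beta> \<nu> \<rho> \<sigma> where "\<mu> \<ge> 1" "\<nu> \<ge> 1"
    and H: "H = generate SU3 {E_mat, F_mat \<mu> \<alpha> \<beta>, R_mat \<nu> \<rho> \<sigma>}" "subgroup H SU3"
    using assms unfolding type_D_def by blast
  then have pos: "\<mu> > 0" "\<nu> > 0" by simp_all
  \<comment> \<open>\<open>M\<close> is a common order for the roots in F and R;
    \<open>(u, v)\<close> is the diagonal part of R and \<open>(a0, b0)\<close> the exponent vector
    of F over it.\<close>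
  define M where "M = \<mu> * (2 * \<nu>)"
  define u v where "u = int \<mu> * (2 * int \<rho> + int \<nu>)" and "v = int \<mu> * (2 * int \<sigma> + int \<nu>)"
  define a0 b0 where "a0 = int (2 * \<nu>) * int \<alpha>" and "b0 = int (2 * \<nu>) * int \<beta>"
  have M: "M > 0" using pos by (simp add: M_def)
  have R: "R_mat \<nu> \<rho> \<sigma> = tor M u v ** B_mat"
    unfolding R_mat_eq_tor_B[OF pos(2)] M_def u_def v_def tor_mult_cancel[OF pos(1)] ..
  have F: "F_mat \<mu> \<alpha> \<beta> = tor M a0 b0"
    using tor_mult_cancel[of "2 * \<nu>" \<mu>] pos
    by (simp only: F_mat_eq_tor M_def a0_def b0_def mult.commute[of \<mu>])
  let ?gens = "{E_mat, tor M a0 b0, tor M u v ** B_mat}"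
  have H': "H = generate SU3 ?gens" unfolding H(1) R F ..
  have EH: "E_mat \<in> H" and FH: "tor M a0 b0 \<in> H" and RH: "tor M u v ** B_mat \<in> H"
    unfolding H' by (auto intro: generate.incl)
  have invR: "inv\<^bsub>SU3\<^esub> (tor M u v ** B_mat) = B_mat ** tor M (- u) (- v)"
    using SU3.inv_mult_group[of "tor M u v" B_mat] by (simp add: B_in_SU3 B_mat_inv tor_inv)
  then have RH': "B_mat ** tor M (- u) (- v) \<in> H"
    using subgroup.m_inv_closed[OF H(2) RH] by simp
  have diff: "tor M (a - a') (b - b') \<in> H" if "tor M a b \<in> H" "tor M a' b' \<in> H" for a b a' b'
    using subgroup_SU3_mult[OF H(2) that(1) subgroup.m_inv_closed[OF H(2) that(2)]]
    by (simp add: tor_inv tor_mult)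
  have shift: "tor M b (- a - b) \<in> H" if "tor M a b \<in> H" for a b
    using that H(2) EH by (metis E_mat_conj_tor subgroup_SU3_mult)
  \<comment> \<open>Diagonal matrices commute, so conjugation by R acts on them as conjugation by B
    does.\<close>
  have refl: "tor M a (- a - b) \<in> H" if "tor M a b \<in> H" for a b
  proof -
    have "(tor M u v ** B_mat) ** tor M a b ** (B_mat ** tor M (- u) (- v)) \<in> H" (is "?C \<in> H")
      by (rule subgroup_SU3_mult[OF H(2) subgroup_SU3_mult[OF H(2) RH that] RH'])
    also have "?C = tor M u v ** (B_mat ** tor M a b ** B_mat) ** tor M (- u) (- v)"
      by (simp only: matrix_mul_assoc)
    finally show ?thesis by (simp add: B_mat_conj_tor tor_mult)
  qed
  \<comment> \<open>Because B E B = E^2 is the inverse of E, the product R E R^-1 E is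
    diagonal.\<close>
  have "tor M (2 * u + v) (v - u) \<in> H"
  proof -
    have "(tor M u v ** B_mat) ** E_mat ** (B_mat ** tor M (- u) (- v)) ** E_mat \<in> H"
      (is "?C \<in> H")
      by (rule subgroup_SU3_mult[OF H(2) subgroup_SU3_mult[OF H(2)
            subgroup_SU3_mult[OF H(2) RH EH] RH'] EH])
    also have "?C = tor M u v ** ((B_mat ** E_mat ** B_mat) ** tor M (- u) (- v) ** E_mat)"
      by (simp only: matrix_mul_assoc)
    finally show ?thesis
      by (simp add: B_mat_E_mat_B_mat E_mat_conj_tor' tor_mult algebra_simps)
  qed
  \<comment> \<open>Shifted and negated, this vector is the diagonal factor in
    \<open>tor_conj_E\<close>.\<close>
  from diff[OF _ shift[OF this], of 0 0] have wH: "tor M (u - v) (u + 2 * v) \<in> H"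
    using subgroup.one_closed[OF H(2)] by (simp add: algebra_simps)
  \<comment> \<open>This diagonal matrix is the square of R. Subtracting its vector from
    \<open>(3 * u, 3 * v)\<close> leaves the diagonal factor in
    \<open>tor_conj_tor_B\<close>.\<close>
  have "tor M (2 * u) (- u) \<in> H"
  proof -
    have "(tor M u v ** B_mat) ** (tor M u v ** B_mat)
        = tor M u v ** (B_mat ** tor M u v ** B_mat)"
      by (simp only: matrix_mul_assoc)
    also have "\<dots> = tor M (2 * u) (- u)"
      by (simp add: B_mat_conj_tor tor_mult)
    finally show ?thesis using subgroup_SU3_mult[OF H(2) RH RH] by simp
  qed
  \<comment> \<open>The vector \<open>w = (u - v, u + 2 * v)\<close> minus its double shift.\<close>
  moreover have "tor M (3 * u) (3 * v) \<in> H"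
    using diff[OF wH shift[OF shift[OF wH]]] by (simp add: algebra_simps)
  ultimately have w'H: "tor M u (u + 3 * v) \<in> H"
    using diff[of "3 * u" "3 * v" "2 * u" "- u"] by (simp add: algebra_simps)

  obtain r n k where *: "r > 0" "n > 0" "k < r" "r dvd 1 + k + k\<^sup>2"
      "F_series (r * n) k \<in> H" "G_series (r * n) n \<in> H"
    and sub: "\<And>S a b. subgroup S SU3 \<Longrightarrow> F_series (r * n) k \<in> S \<Longrightarrow> G_series (r * n) n \<in> S \<Longrightarrow>
       tor M a b \<in> H \<Longrightarrow> tor M a b \<in> S"
    and "(\<And>a b. tor M a b \<in> H \<Longrightarrow> tor M a (- a - b) \<in> H) \<Longrightarrow> r dvd 3"
    by (rule tor_lattice[OF H(2) EH M]) blast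
  then have r3: "r dvd 3" using refl by blast

  let ?\<phi> = "tor_conj M u v"
  let ?S = "generate SU3 {E_mat, F_series (r * n) k, G_series (r * n) n, B_mat}"
  interpret \<phi>: group_hom SU3 SU3 ?\<phi> by (rule tor_conj_hom)
  have S: "subgroup ?S SU3"
    by (rule SU3.generate_is_subgroup)
      (auto simp: E_in_SU3 B_in_SU3 F_series_in_SU3 G_series_in_SU3)
  have gens_carrier: "?gens \<subseteq> carrier SU3"
    using H(2) EH FH RH subgroup.subset by blast
  have \<phi>H: "?\<phi> ` H = generate SU3 (?\<phi> ` ?gens)"
    unfolding H' by (rule \<phi>.generate_img[OF gens_carrier, symmetric])
  have \<phi>H_subgroup: "subgroup (?\<phi> ` H) SU3"
    by (rule \<phi>.subgroup_img_is_subgroup[OF H(2)])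
  have S_gens: "E_mat \<in> ?S" "B_mat \<in> ?S" "F_series (r * n) k \<in> ?S" "G_series (r * n) n \<in> ?S"
    by (auto intro: generate.incl)
  have \<phi>H_tor: "tor M a b \<in> ?\<phi> ` H" if "tor M a b \<in> H" for a b
    using that by (metis image_eqI tor_conj_tor)
  have \<phi>H_gens: "tor M (u - v) (u + 2 * v) ** E_mat \<in> ?\<phi> ` H"
      "tor M u (u + 3 * v) ** B_mat \<in> ?\<phi> ` H"
    using EH RH by (metis image_eqI tor_conj_E, metis image_eqI tor_conj_tor_B)
  have "?\<phi> ` H \<subseteq> ?S"
    unfolding \<phi>H
    using sub[OF S S_gens(3,4)] wH w'H FH S_gens
    by (intro SU3.generate_subgroup_incl[OF _ S])
      (auto simp: tor_conj_E tor_conj_tor_B intro: subgroup_SU3_mult[OF S])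
  moreover have "?S \<subseteq> ?\<phi> ` H"
  proof (rule SU3.generate_subgroup_incl[OF _ \<phi>H_subgroup])
    have "E_mat \<in> ?\<phi> ` H" "B_mat \<in> ?\<phi> ` H"
      using mult_mem_cancel[OF \<phi>H_subgroup \<phi>H_tor[OF wH] \<phi>H_gens(1) E_in_SU3]
        mult_mem_cancel[OF \<phi>H_subgroup \<phi>H_tor[OF w'H] \<phi>H_gens(2) B_in_SU3] by auto
    moreover have "F_series (r * n) k \<in> ?\<phi> ` H" "G_series (r * n) n \<in> ?\<phi> ` H"
      using *(5,6) unfolding F_series_eq_tor G_series_eq_tor by (metis image_eqI tor_conj_tor)+
    ultimately show "{E_mat, F_series (r * n) k, G_series (r * n) n, B_mat} \<subseteq> ?\<phi> ` H"
      by blast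
  qed
  ultimately have \<phi>H_eq: "?\<phi> ` H = ?S" by blast
  have "?\<phi> \<in> iso (SU3\<lparr>carrier := H\<rparr>) (D_group (r * n) n k)"
  proof (rule isoI)
    show "?\<phi> \<in> hom (SU3\<lparr>carrier := H\<rparr>) (D_group (r * n) n k)"
      using \<phi>H_eq
      by (auto simp: hom_def D_group_def \<phi>.hom_mult subgroup.mem_carrier[OF H(2)]
          simp del: SU3_simps)
    show "bij_betw ?\<phi> (carrier (SU3\<lparr>carrier := H\<rparr>)) (carrier (D_group (r * n) n k))"
      using \<phi>H_eq inj_on_subset[OF inj_tor_conj subset_UNIV] by (auto simp: D_group_def bij_betw_def)
  qed
  then show ?thesis
    using that[of n k r] * r3 is_isoI by blast
qed

section \<open>Splitting off the scalar matrices of order 3\<close>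

text \<open>A property stable under products that all elements of a series group share. It shows
  that such a group contains no scalar of order 3 when 3 does not divide \<open>m\<close>.\<close>

definition monomial_roots :: "nat \<Rightarrow> complex^3^3 \<Rightarrow> bool" where
  "monomial_roots l A \<longleftrightarrow>
     (\<exists>\<sigma> x. (\<forall>i. x i ^ l = 1) \<and> A = (\<chi> i j. if j = \<sigma> i then x i else 0))"

lemma monomial_roots_mult:
  assumes "monomial_roots l A" "monomial_roots l A'"
  shows "monomial_roots l (A ** A')"
proof -
  obtain \<sigma> x where x: "\<forall>i. x i ^ l = 1" and A: "A = (\<chi> i j. if j = \<sigma> i then x i else 0)"
    using assms(1) unfolding monomial_roots_def by blast
  obtain \<sigma>' x' where x': "\<forall>i. x' i ^ l = 1"
    and A': "A' = (\<chi> i j. if j = \<sigma>' i then x' i else 0)"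
    using assms(2) unfolding monomial_roots_def by blast
  have "A ** A' = (\<chi> i j. if j = \<sigma>' (\<sigma> i) then x i * x' (\<sigma> i) else 0)"
    by (simp add: A A' matrix_matrix_mult_def vec_eq_iff mult_delta_left)
  moreover have "\<forall>i. (x i * x' (\<sigma> i)) ^ l = 1"
    using x x' by (simp add: power_mult_distrib)
  ultimately show ?thesis
    unfolding monomial_roots_def
    by (intro exI[of _ "\<lambda>i. \<sigma>' (\<sigma> i)"] exI[of _ "\<lambda>i. x i * x' (\<sigma> i)"]) simp
qed

text \<open>The exponent is \<open>2 * m\<close> to leave room for the entries -1 of B; the factor 2
  is harmless in a comparison with cube roots of unity.\<close>

lemma monomial_roots_tor: "monomial_roots (2 * m) (tor m a b)"
proof -
  have pow: "(root_unity m powi c) ^ (2 * m) = 1" for c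
    by (metis mult.commute power_int_mult power_int_of_nat power_int_1_left root_unity_power_self power_mult power_one)
  show ?thesis
    unfolding monomial_roots_def
    by (intro exI[of _ id]
        exI[of _ "\<lambda>i. if i = 1 then root_unity m powi a else
          if i = 2 then root_unity m powi b else root_unity m powi (- a - b)"])
      (simp add: pow tor_def mat3_simps)
qed

lemma monomial_roots_E: "monomial_roots l E_mat"
  unfolding monomial_roots_def
  \<comment> \<open>Arithmetic in the index type \<open>3\<close> is modulo 3, so this is the cyclic
    permutation.\<close>
  by (intro exI[of _ "\<lambda>i. i + 1"] exI[of _ "\<lambda>i. 1"]) (simp add: E_mat_def mat3_simps)

lemma monomial_roots_B: "monomial_roots (2 * m) B_mat"
  unfolding monomial_roots_def
  \<comment> \<open>Modulo 3 this map fixes 1 and exchanges 2 and 3.\<close>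
  by (intro exI[of _ "\<lambda>i. - i - 1"] exI[of _ "\<lambda>i. - 1"]) (simp add: B_mat_def mat3_simps)

lemma monomial_roots_generate:
  assumes "A \<in> generate SU3 (X \<union> {F_series m k, G_series m n})" "X \<subseteq> {E_mat, B_mat}"
  shows "monomial_roots (2 * m) A"
  using assms(1)
proof (induction rule: generate.induct)
  case one
  show ?case using monomial_roots_tor[of m 0 0] by simp
next
  case (incl h)
  then show ?case
    using assms(2) monomial_roots_E monomial_roots_B monomial_roots_tor
    by (auto simp: F_series_eq_tor G_series_eq_tor)
next
  case (inv h)
  then have "h = E_mat \<or> h = B_mat \<or> h = F_series m k \<or> h = G_series m n"
    using assms(2) by blast
  then show ?case
    by (elim disjE) (simp_all add: F_series_eq_tor G_series_eq_tor tor_inv E_mat_inv B_mat_inv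
        monomial_roots_mult monomial_roots_E monomial_roots_B monomial_roots_tor)
next
  case (eng h1 h2)
  then show ?case by (simp add: monomial_roots_mult)
qed

text \<open>The third exponent \<open>-2 * i\<close> agrees with \<open>i\<close> modulo 3, so all
  three entries coincide.\<close>

lemma tor_3_scalar: "tor 3 i i = (\<chi> p q. if p = q then root_unity 3 powi i else 0)"
proof -
  have "- (2 * i) = i - 3 * i" by simp
  then have "root_unity 3 powi (- (2 * i)) = root_unity 3 powi (i - 3 * i)" by (rule arg_cong)
  also have "\<dots> = root_unity 3 powi i / (root_unity 3 ^ 3) powi i"
    by (subst power_int_diff) (simp_all add: power_int_mult)
  also have "\<dots> = root_unity 3 powi i"
    by (simp only: root_unity_power_self) simp
  finally show ?thesis by (simp add: tor_def mat3_simps)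
qed

lemma tor_3_central: "tor 3 i i ** A = A ** tor 3 i i"
  by (simp add: tor_3_scalar matrix_matrix_mult_def vec_eq_iff if_distrib if_distribR mult.commute
      cong: if_cong)

lemma tor_3_mod: "tor 3 (i mod 3) (i mod 3) = tor 3 i i"
proof -
  have "root_unity 3 powi i = root_unity 3 powi (i mod 3 + 3 * (i div 3))" by simp
  also have "\<dots> = root_unity 3 powi (i mod 3) * (root_unity 3 ^ 3) powi (i div 3)"
    by (subst power_int_add) (simp_all add: power_int_mult)
  also have "\<dots> = root_unity 3 powi (i mod 3)"
    using root_unity_power_self[of 3] by simp
  finally show ?thesis by (simp add: tor_3_scalar cong: if_cong)
qed

text \<open>The first diagonal entry is a power of a primitive cube root of unity and also a root of
  unity of order dividing \<open>2 * m\<close>, a number prime to 3.\<close>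

lemma monomial_roots_tor_3_imp:
  assumes "monomial_roots (2 * m) (tor 3 i i)" "\<not> 3 dvd m"
  shows "3 dvd i"
proof -
  define j where "j = nat (i mod 3)"
  have j: "int j = i mod 3" by (simp add: j_def)
  obtain \<sigma> x where x: "\<forall>p. x p ^ (2 * m) = 1"
    and A: "tor 3 (int j) (int j) = (\<chi> p q. if q = \<sigma> p then x p else 0)"
    using assms(1) unfolding monomial_roots_def j tor_3_mod by blast
  then have "tor 3 (int j) (int j) $ 1 $ 1 = (if 1 = \<sigma> 1 then x 1 else 0)"
    by simp
  then have "(if 1 = \<sigma> 1 then x 1 else 0) = root_unity 3 powi int j"
    by (simp add: tor_3_scalar)
  then have "x 1 = root_unity 3 ^ j" by (simp split: if_splits)
  then have "root_unity 3 ^ (j * (2 * m)) = 1" using x by (metis power_mult)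
  then have "3 dvd j * (2 * m)" by (subst (asm) root_unity_power_eq_1_iff) simp_all
  then have "3 dvd j"
    using assms(2) by (simp add: prime_dvd_mult_iff)
  then have "3 dvd i mod 3" using j by presburger
  then show ?thesis by presburger
qed

text \<open>The map \<open>h\<close> sends \<open>(i, g)\<close> to the scalar
  \<open>tor 3 i i\<close> times \<open>g\<close>. It is a homomorphism because scalars are central,
  onto because diagonal generators split accordingly, and injective because the smaller group has no
  scalar of order 3. The set \<open>X\<close> covers types C and D together; \<open>k'\<close> need
  only agree with \<open>k\<close> modulo \<open>r'\<close>, which lets D pass from 1 to 0.\<close>

lemma Z3_times_generate:
  fixes m n r' k k' :: nat
  assumes X: "X \<subseteq> {E_mat, B_mat}" and n: "n > 0" and m: "m = r' * n" "\<not> 3 dvd m"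
    and k: "int r' dvd int k - int k'" "k mod 3 = 1"
  shows "SU3\<lparr>carrier := generate SU3 (X \<union> {F_series (3 * m) k, G_series (3 * m) n})\<rparr> \<cong>
    integer_mod_group 3 \<times>\<times> SU3\<lparr>carrier := generate SU3 (X \<union> {F_series m k', G_series m n})\<rparr>"
proof -
  define L where "L = generate SU3 (X \<union> {F_series (3 * m) k, G_series (3 * m) n})"
  define K where "K = generate SU3 (X \<union> {F_series m k', G_series m n})"
  define h where "h = (\<lambda>(i, g :: complex^3^3). tor 3 i i ** g)"
  have X_carrier: "X \<subseteq> carrier SU3" using X E_in_SU3 B_in_SU3 by blast
  have L: "subgroup L SU3" and K: "subgroup K SU3"
    unfolding L_def K_def using X_carrier
    by (auto intro!: SU3.generate_is_subgroup simp: F_series_in_SU3 G_series_in_SU3)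
  have XL: "X \<subseteq> L" and XK: "X \<subseteq> K"
    unfolding L_def K_def by (auto intro: generate.incl)
  have tor_L: "tor (3 * m) a b \<in> L" if "int (3 * r') dvd b - int k * a" for a b
  proof -
    have "tor (3 * r' * n) a b \<in> L"
      by (rule tor_mem_if_series_mem[OF L _ _ n that])
        (auto simp: L_def m(1) mult.assoc intro: generate.incl)
    then show ?thesis by (simp add: m(1) mult.assoc)
  qed
  have tor_K: "tor m a b \<in> K" if "int r' dvd b - int k' * a" for a b
  proof -
    have "tor (r' * n) a b \<in> K"
      by (rule tor_mem_if_series_mem[OF K _ _ n that])
        (auto simp: K_def m(1) intro: generate.incl)
    then show ?thesis by (simp add: m(1))
  qed
  have m_pos: "m > 0" using m(2) by (cases m) auto
  have tor3: "tor 3 i i = tor (3 * m) (i * int m) (i * int m)" for i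
    using tor_mult_cancel[OF m_pos, of 3 i i] by (simp add: mult.commute)
  have tor_m: "tor m a b = tor (3 * m) (3 * a) (3 * b)" for a b
    using tor_mult_cancel[of 3 m a b] by simp
  have k3: "3 dvd int k - 1" using k(2) by presburger

  \<comment> \<open>The vector \<open>(i * m, i * m)\<close> lies in the lattice of \<open>L\<close>
    because 3 divides \<open>k - 1\<close> and \<open>r'\<close> divides \<open>m\<close>.\<close>
  have tor3_L: "tor 3 i i \<in> L" for i
    unfolding tor3
  proof (rule tor_L)
    have "int r' dvd int m" using m(1) by simp
    then have "3 * int r' dvd (int k - 1) * int m" by (rule mult_dvd_mono[OF k3])
    then have "3 * int r' dvd (int k - 1) * int m * (- i)" by (rule dvd_mult2)
    then show "int (3 * r') dvd i * int m - int k * (i * int m)"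
      by (simp add: algebra_simps)
  qed
  have "K \<subseteq> L"
    unfolding K_def
  proof (rule SU3.generate_subgroup_incl[OF _ L])
    have "3 * int r' dvd 3 * (int k' - int k)"
      using k(1) by (subst dvd_mult_cancel_left) (simp add: dvd_diff_commute)
    then have "F_series m k' \<in> L" unfolding F_series_eq_tor tor_m
      by (intro tor_L) (simp add: algebra_simps)
    moreover have "G_series m n \<in> L" unfolding G_series_eq_tor tor_m
      by (intro tor_L) (use m n in simp)
    ultimately show "X \<union> {F_series m k', G_series m n} \<subseteq> L" using XL by blast
  qed

  have split: "\<exists>i. \<exists>g\<in>K. tor (3 * m) a b = tor 3 i i ** g" if "int (3 * r') dvd b - int k * a" for a b
  proof -
    \<comment> \<open>As m^2 = 1 modulo 3, this choice makes \<open>i * m\<close> congruent to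
      \<open>a\<close> modulo 3, so removing the scalar leaves a first exponent divisible by
      3.\<close>
    define i where "i = a * int m"
    have "3 dvd int m - 1 \<or> 3 dvd int m + 1" using m(2) by presburger
    then have "3 dvd (int m - 1) * (int m + 1)" by auto
    then have "3 dvd int m * int m - 1" by (simp add: algebra_simps)
    then have "3 dvd (int m * int m - 1) * (- a)" by (rule dvd_mult2)
    then have a3: "3 dvd a - i * int m" by (simp add: i_def algebra_simps)
    \<comment> \<open>The same scalar serves the second exponent: modulo 3, \<open>b\<close> equals
      \<open>k * a\<close>, which equals \<open>a\<close> since \<open>k\<close> is 1 modulo
      3.\<close>
    have "3 dvd b - int k * a" using that by (metis dvd_mult_left of_nat_mult of_nat_numeral)
    moreover have "3 dvd (int k - 1) * a" using k3 by (rule dvd_mult2)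
    ultimately have "3 dvd (b - int k * a) + (int k - 1) * a + (a - i * int m)"
      using a3 by (intro dvd_add)
    then have b3: "3 dvd b - i * int m" by (simp add: algebra_simps)
    obtain a' where a': "a - i * int m = 3 * a'" using a3 by blast
    obtain b' where b': "b - i * int m = 3 * b'" using b3 by blast
    have "3 * (b' - int k * a') = (b - int k * a) + i * ((int k - 1) * int m)"
      using a' b' by (simp add: algebra_simps)
    moreover have "3 * int r' dvd (int k - 1) * int m"
      using k3 m(1) by (intro mult_dvd_mono) auto
    ultimately have "3 * int r' dvd 3 * (b' - int k * a')"
      using that by simp
    then have "int r' dvd b' - int k * a'" by (subst (asm) dvd_mult_cancel_left) simp
    moreover have "int r' dvd (int k - int k') * a'" using k(1) by (rule dvd_mult2)
    ultimately have "int r' dvd (b' - int k * a') + (int k - int k') * a'" by (rule dvd_add)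
    then have "tor m a' b' \<in> K" by (intro tor_K) (simp add: algebra_simps)
    moreover have "tor (3 * m) a b = tor 3 i i ** tor m a' b'"
      unfolding tor3 tor_m tor_mult using a' b' by (simp flip: a' b')
    ultimately show ?thesis by blast
  qed

  have h_mult: "h ((i + j) mod 3, g ** g') = h (i, g) ** h (j, g')" for i j g g'
  proof -
    have "h (i, g) ** h (j, g') = tor 3 i i ** (g ** tor 3 j j) ** g'"
      by (simp add: h_def matrix_mul_assoc)
    also have "\<dots> = (tor 3 i i ** tor 3 j j) ** (g ** g')"
      by (simp only: tor_3_central[of j g, symmetric] matrix_mul_assoc)
    finally show ?thesis
      by (simp add: h_def tor_mult tor_3_mod)
  qed
  have hL: "h (i, g) \<in> L" if "g \<in> K" for i g
    using subgroup_SU3_mult[OF L tor3_L] that \<open>K \<subseteq> L\<close> by (auto simp: h_def)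
  let ?P = "integer_mod_group 3 \<times>\<times> SU3\<lparr>carrier := K\<rparr>"
  have "group ?P"
    by (intro DirProd_group group_integer_mod_group SU3.subgroup_imp_group K)
  moreover have "h \<in> hom ?P SU3"
    using hL subgroup.mem_carrier[OF L] by (auto intro!: homI simp: h_mult)
  ultimately interpret h: group_hom ?P SU3 h
    by (simp add: group_hom_def group_hom_axioms_def group_SU3)
  have image: "tor 3 i i ** g \<in> h ` carrier ?P" if "g \<in> K" for i g
  proof (rule image_eqI[of _ _ "(i mod 3, g)"])
    show "tor 3 i i ** g = h (i mod 3, g)" by (simp add: h_def tor_3_mod)
  qed (use that in \<open>simp add: carrier_integer_mod_group\<close>)
  have "L \<subseteq> h ` carrier ?P"
    unfolding L_def
  proof (rule SU3.generate_subgroup_incl[OF _ h.img_is_subgroup])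
    have "X \<subseteq> h ` carrier ?P" using image[of _ 0] XK by auto
    moreover have "F_series (3 * m) k \<in> h ` carrier ?P"
      using split[of "int k" 1] image unfolding F_series_eq_tor by auto
    moreover have "G_series (3 * m) n \<in> h ` carrier ?P"
      using split[of "- int (3 * m div n)" 0] image n unfolding G_series_eq_tor
      by (auto simp: m(1))
    ultimately show "X \<union> {F_series (3 * m) k, G_series (3 * m) n} \<subseteq> h ` carrier ?P" by blast
  qed
  then have surj: "h ` carrier ?P = L"
    using hL by auto
  have "inj_on h (carrier ?P)"
  proof (subst h.inj_on_one_iff, safe)
    fix i g assume ig: "(i, g) \<in> carrier ?P" and "h (i, g) = \<one>\<^bsub>SU3\<^esub>"
    then have one: "tor 3 i i ** g = mat 1" by (simp add: h_def)
    \<comment> \<open>A kernel element has as second component a scalar in \<open>K\<close>, to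
      which the monomial criterion applies.\<close>
    have "g = (tor 3 (- i) (- i) ** tor 3 i i) ** g" by (simp add: tor_mult)
    then have g: "g = tor 3 (- i) (- i)" using one by (simp flip: matrix_mul_assoc)
    have "monomial_roots (2 * m) g"
      using ig X monomial_roots_generate by (auto simp: K_def)
    then have "3 dvd - i" using g m(2) monomial_roots_tor_3_imp by blast
    moreover have "0 \<le> i" "i < 3" using ig by (simp_all add: carrier_integer_mod_group)
    ultimately have "i = 0" by presburger
    then show "(i, g) = \<one>\<^bsub>?P\<^esub>" using g by simp
  qed
  then have "h \<in> iso ?P (SU3\<lparr>carrier := L\<rparr>)"
    using surj by (auto intro!: isoI simp: hom_def bij_betw_def h_mult)
  then have "?P \<cong> SU3\<lparr>carrier := L\<rparr>" by (rule is_isoI)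
  then show ?thesis
    unfolding L_def K_def by (rule group.iso_sym[rotated]) (fact \<open>group ?P\<close>[unfolded K_def])
qed

section \<open>The two classifications\<close>

text \<open>If 3 does not divide \<open>r\<close>, the first series results. Otherwise
  \<open>r = 3 * r'\<close> with \<open>r'\<close> prime to 3; the third series is the case where 3
  divides \<open>n\<close>, and in the remaining case the scalars split off, giving the
  second.\<close>

lemma type_C_classification:
  assumes "type_C H"
  shows "(\<exists>r n k. prod_primes_6z1 r \<and> n \<ge> 1 \<and> k \<in> {0..r - 1} \<and> [1 + k + k\<^sup>2 = 0] (mod r) \<and>
           SU3\<lparr>carrier := H\<rparr> \<cong> C_group (r * n) n k) \<or>
        (\<exists>r' r n k. prod_primes_6z1 r' \<and> r = 3 * r' \<and> n \<ge> 1 \<and> \<not> 3 dvd n \<and>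
           k \<in> {0..r - 1} \<and> [1 + k + k\<^sup>2 = 0] (mod r) \<and>
           SU3\<lparr>carrier := H\<rparr> \<cong> integer_mod_group 3 \<times>\<times> C_group (r' * n) n k) \<or>
        (\<exists>r' r n' k. prod_primes_6z1 r' \<and> r = 3 * r' \<and> n' \<ge> 1 \<and>
           k \<in> {0..r - 1} \<and> [1 + k + k\<^sup>2 = 0] (mod r) \<and>
           SU3\<lparr>carrier := H\<rparr> \<cong> C_group (9 * r' * n') (3 * n') k)"
    (is "?C1 \<or> ?C2 \<or> ?C3")
proof -
  obtain r n k where *: "r > 0" "n > 0" "k < r" "r dvd 1 + k + k\<^sup>2"
    and H: "SU3\<lparr>carrier := H\<rparr> = C_group (r * n) n k"
    by (rule type_C_eq_C_group[OF assms])
  have n: "n \<ge> 1" and k: "k \<in> {0..r - 1}" and cong: "[1 + k + k\<^sup>2 = 0] (mod r)"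
    using * by (simp_all add: cong_0_iff)
  show ?thesis
  proof (cases "3 dvd r")
    case False
    then have "prod_primes_6z1 r" using *(4) by (intro prod_primes_6z1_if_dvd)
    then have ?C1 using n k cong H iso_refl by metis
    then show ?thesis ..
  next
    case True
    then obtain r' where r: "r = 3 * r'" by blast
    have "\<not> 3 dvd r'"
    proof
      assume "3 dvd r'"
      then have "9 dvd r" unfolding r by presburger
      then show False using *(4) not_9_dvd_eisenstein_norm dvd_trans by blast
    qed
    moreover have "r' dvd 1 + k + k\<^sup>2" using *(4) r by (metis dvd_mult_right)
    ultimately have r': "prod_primes_6z1 r'" "\<not> 3 dvd r'" by (simp_all add: prod_primes_6z1_if_dvd)
    show ?thesis
    proof (cases "3 dvd n")
      case True
      then obtain n' where n': "n = 3 * n'" by blast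
      have "r * n = 9 * r' * n'" by (simp add: r n')
      then have "SU3\<lparr>carrier := H\<rparr> \<cong> C_group (9 * r' * n') (3 * n') k"
        using H n' iso_refl by metis
      moreover have "n' \<ge> 1" using n n' by simp
      ultimately have ?C3 using r' r k cong by blast
      then show ?thesis by blast
    next
      case False
      have "k mod 3 = 1"
        using \<open>3 dvd r\<close> *(4) dvd_trans mod_3_eq_1_if_dvd by blast
      moreover have "\<not> 3 dvd r' * n" using False r'(2) by (simp add: prime_dvd_mult_iff)
      ultimately have "SU3\<lparr>carrier := H\<rparr> \<cong> integer_mod_group 3 \<times>\<times> C_group (r' * n) n k"
        using Z3_times_generate[of "{E_mat}" n "r' * n" r' k k] *(2) H
        by (simp add: C_group_def r mult.assoc insert_commute)
      then have ?C2 using r' r n k cong False by blast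
      then show ?thesis by blast
    qed
  qed
qed

text \<open>Here \<open>r\<close> is 1 or 3, which forces \<open>k\<close> to be 0 or 1
  respectively; for \<open>r = 3\<close> the cases again depend on whether 3 divides
  \<open>n\<close>.\<close>

lemma type_D_classification:
  assumes "type_D H"
  shows "(\<exists>n\<ge>1. SU3\<lparr>carrier := H\<rparr> \<cong> D_group n n 0) \<or>
        (\<exists>n\<ge>1. \<not> 3 dvd n \<and> SU3\<lparr>carrier := H\<rparr> \<cong> integer_mod_group 3 \<times>\<times> D_group n n 0) \<or>
        (\<exists>n'\<ge>1. SU3\<lparr>carrier := H\<rparr> \<cong> D_group (9 * n') (3 * n') 1)"
    (is "?D1 \<or> ?D2 \<or> ?D3")
proof -
  obtain r n k where *: "n > 0" "k < r" "r dvd 1 + k + k\<^sup>2" "r dvd 3"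
    and H: "SU3\<lparr>carrier := H\<rparr> \<cong> D_group (r * n) n k"
    by (rule type_D_iso_D_group[OF assms])
  have n: "n \<ge> 1" using *(1) by simp
  have "prime (3::nat)" by simp
  then have "r = 1 \<or> r = 3" using *(4) prime_nat_iff by blast
  then show ?thesis
  proof
    assume "r = 1"
    then have ?D1 using H n *(2) by auto
    then show ?thesis ..
  next
    assume r: "r = 3"
    then have "k mod 3 = 1" using *(3) mod_3_eq_1_if_dvd by blast
    then have k: "k = 1" using *(2) r by simp
    show ?thesis
    proof (cases "3 dvd n")
      case True
      then obtain n' where n': "n = 3 * n'" by blast
      have "r * n = 9 * n'" by (simp add: r n')
      then have "SU3\<lparr>carrier := H\<rparr> \<cong> D_group (9 * n') (3 * n') 1"
        using H k n' by metis
      moreover have "n' \<ge> 1" using n n' by simp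
      ultimately show ?thesis by blast
    next
      case False
      \<comment> \<open>With \<open>r' = 1\<close> the congruence between \<open>k = 1\<close> and
        \<open>k' = 0\<close> is vacuous.\<close>
      have "D_group (3 * n) n 1 \<cong> integer_mod_group 3 \<times>\<times> D_group n n 0"
        using Z3_times_generate[of "{E_mat, B_mat}" n n 1 1 0] *(1) False
        by (simp add: D_group_def insert_commute)
      then have "SU3\<lparr>carrier := H\<rparr> \<cong> integer_mod_group 3 \<times>\<times> D_group n n 0"
        using H iso_trans by (simp add: r k) blast
      then show ?thesis using n False by blast
    qed
  qed
qed

theorem mainTheorem4:
  fixes H :: "(complex^3^3) set"
  shows
    "(type_C H \<longrightarrow>
        (\<exists>r n k. prod_primes_6z1 r \<and> n \<ge> 1 \<and> k \<in> {0..r - 1} \<and> [1 + k + k\<^sup>2 = 0] (mod r) \<and>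
           SU3\<lparr>carrier := H\<rparr> \<cong> C_group (r * n) n k) \<or>
        (\<exists>r' r n k. prod_primes_6z1 r' \<and> r = 3 * r' \<and> n \<ge> 1 \<and> \<not> 3 dvd n \<and>
           k \<in> {0..r - 1} \<and> [1 + k + k\<^sup>2 = 0] (mod r) \<and>
           SU3\<lparr>carrier := H\<rparr> \<cong> integer_mod_group 3 \<times>\<times> C_group (r' * n) n k) \<or>
        (\<exists>r' r n' k. prod_primes_6z1 r' \<and> r = 3 * r' \<and> n' \<ge> 1 \<and>
           k \<in> {0..r - 1} \<and> [1 + k + k\<^sup>2 = 0] (mod r) \<and>
           SU3\<lparr>carrier := H\<rparr> \<cong> C_group (9 * r' * n') (3 * n') k)) \<and>
     (type_D H \<longrightarrow>
        (\<exists>n\<ge>1. SU3\<lparr>carrier := H\<rparr> \<cong> D_group n n 0) \<or>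
        (\<exists>n\<ge>1. \<not> 3 dvd n \<and> SU3\<lparr>carrier := H\<rparr> \<cong> integer_mod_group 3 \<times>\<times> D_group n n 0) \<or>
        (\<exists>n'\<ge>1. SU3\<lparr>carrier := H\<rparr> \<cong> D_group (9 * n') (3 * n') 1))"
  using type_C_classification type_D_classification by blast

end
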